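(* Let $p$ be an increment distribution on $\mathbb{N}=\{1,2,3,\dots\}$ such that $p(1)\geq\beta>0$, and let $u(n)$ be the associated renewal sequence with zero delay. Suppose there exist $r>1$ and $B<\infty$ such that $$\sum_{n=1}^\infty p(n)\,r^n\ \leq\ B.$$ Then there exist an invariant distribution $e(n)$ (indexed as a delay distribution on $\mathbb{N}\cup\{0\}$) for the forward recurrence time chain, a constant $\pi(1)$ with $\pi(1)=(e*u)(n)$ for all $n$, and an effective bound $\rho>1$ depending only (and explicitly) on $r,\beta,B$, such that for every $0<r_2\leq\rho$ there is an effective bound $L<\infty$, depending only (and explicitly) on $r_2,B,\beta,\rho$, with $$\sum_{n=1}^\infty|u(n)-\pi(1)|\,r_2^n\ \leq\ L.$$
   Context: An increment distribution is a sequence $p:\mathbb{N}\to\mathbb{R}_{\geq0}$ with $\sum_{n=1}^\infty p(n)=1$; a delay distribution is a sequence $d:\mathbb{N}\cup\{0\}\to\mathbb{R}_{\geq0}$ with $\sum_{n=0}^\infty d(n)=1$. Let $Y_1,Y_2,\dots$ be i.i.d. with $\mathbb{P}\{Y_i=n\}=p(n)$, let $Y_0$ be independent of them with law $d$, and set $S^d_m=\sum_{i=0}^mY_i$. The renewal sequence with delay $d$ is $$v_d(n)=\mathbb{P}\{S^d_m=n\text{ for some }m\geq0\}=\sum_{m=0}^\infty (d*p^{*m})(n),\qquad n\geq0,$$ where $(f*g)(n)=\sum_{k=0}^nf(k)g(n-k)$ is convolution of sequences on $\mathbb{N}\cup\{0\}$ (with $p(0)=0$), $p^{*m}$ is the $m$-fold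 convolution power and $p^{*0}$ is the unit mass at $0$. The renewal sequence with zero delay is the one with $d(0)=1$, namely $u(n)=\sum_{m=0}^\infty p^{*m}(n)$; thus $v_d=d*u$. The forward recurrence time chain is the Markov chain on $\mathbb{N}$ with transition probabilities $P(n,n-1)=1$ if $n>1$, and $P(1,m)=p(m)$ for $m\in\mathbb{N}$. A delay $n\in\mathbb{N}\cup\{0\}$ corresponds to the state $n+1\in\mathbb{N}$ of this chain; so a delay distribution $e$ on $\mathbb{N}\cup\{0\}$ is an invariant distribution for the chain when the probability measure $m\mapsto e(m-1)$ on $\mathbb{N}$ is invariant for $P$. "Depending only (and explicitly) on" given numbers means being given by an explicit function of these numbers alone, the same for all increment distributions satisfying the hypotheses with these values. *)

theory Defs
  imports "HOL-Analysis.Analysis"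
begin

text \<open>Sequences indexed by the positive integers are functions on \<^typ>\<open>nat\<close> that vanish at 0,
  so that they can be convolved with sequences indexed by the nonnegative integers.\<close>

definition increment_distribution :: "(nat \<Rightarrow> real) \<Rightarrow> bool" where
  "increment_distribution p \<longleftrightarrow> p 0 = 0 \<and> (\<forall>n\<ge>1. 0 \<le> p n) \<and> (p has_sum 1) {1..}"

definition delay_distribution :: "(nat \<Rightarrow> real) \<Rightarrow> bool" where
  "delay_distribution d \<longleftrightarrow> (\<forall>n. 0 \<le> d n) \<and> (d has_sum 1) UNIV"

definition conv :: "(nat \<Rightarrow> real) \<Rightarrow> (nat \<Rightarrow> real) \<Rightarrow> nat \<Rightarrow> real" where
  "conv f g n = (\<Sum>k=0..n. f k * g (n - k))"

definition unit_mass :: "nat \<Rightarrow> real" where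
  "unit_mass n = (if n = 0 then 1 else 0)"

primrec conv_power :: "(nat \<Rightarrow> real) \<Rightarrow> nat \<Rightarrow> nat \<Rightarrow> real" where
  "conv_power p 0 = unit_mass"
| "conv_power p (Suc m) = conv p (conv_power p m)"

text \<open>If \<open>p 0 = 0\<close>, then \<open>conv_power p m n = 0\<close> for \<open>m > n\<close>, so the series over \<open>m\<close>
  has only finitely many nonzero terms.\<close>

definition renewal_sequence :: "(nat \<Rightarrow> real) \<Rightarrow> (nat \<Rightarrow> real) \<Rightarrow> nat \<Rightarrow> real" where
  "renewal_sequence d p n = (\<Sum>m. conv d (conv_power p m) n)"

definition zero_delay_renewal :: "(nat \<Rightarrow> real) \<Rightarrow> nat \<Rightarrow> real" where
  "zero_delay_renewal p = renewal_sequence unit_mass p"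

text \<open>Transition probabilities of the forward recurrence time chain; the state space is
  \<open>{1..}\<close>, and the values at \<open>n = 0\<close> or \<open>m = 0\<close> are irrelevant.\<close>

definition forward_transition :: "(nat \<Rightarrow> real) \<Rightarrow> nat \<Rightarrow> nat \<Rightarrow> real" where
  "forward_transition p n m =
     (if n > 1 then (if m = n - 1 then 1 else 0) else p m)"

definition invariant_distribution :: "(nat \<Rightarrow> nat \<Rightarrow> real) \<Rightarrow> (nat \<Rightarrow> real) \<Rightarrow> bool" where
  "invariant_distribution P \<mu> \<longleftrightarrow>
     (\<forall>n\<ge>1. 0 \<le> \<mu> n) \<and> (\<mu> has_sum 1) {1..} \<and>
     (\<forall>m\<ge>1. ((\<lambda>n. \<mu> n * P n m) has_sum \<mu> m) {1..})"

text \<open>Delay \<open>n\<close> corresponds to state \<open>n + 1\<close>.\<close>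

definition invariant_delay :: "(nat \<Rightarrow> real) \<Rightarrow> (nat \<Rightarrow> real) \<Rightarrow> bool" where
  "invariant_delay p e \<longleftrightarrow> delay_distribution e \<and>
     invariant_distribution (forward_transition p) (\<lambda>m. e (m - 1))"

text \<open>A real function is explicit in the coordinate functions \<open>V\<close> if it is given by one fixed
  closed-form expression, built from the coordinates and rational constants. This makes
  ``depending only (and explicitly) on'' precise. Division, \<open>ln\<close> and \<open>powr\<close> are the total
  functions of the library, so no domain conditions are needed.\<close>

inductive explicit_function :: "('a \<Rightarrow> real) set \<Rightarrow> ('a \<Rightarrow> real) \<Rightarrow> bool"
  for V :: "('a \<Rightarrow> real) set" where
  coord: "v \<in> V \<Longrightarrow> explicit_function V v"
| const: "explicit_function V (\<lambda>_. of_rat q)"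
| add: "explicit_function V f \<Longrightarrow> explicit_function V g \<Longrightarrow> explicit_function V (\<lambda>x. f x + g x)"
| diff: "explicit_function V f \<Longrightarrow> explicit_function V g \<Longrightarrow> explicit_function V (\<lambda>x. f x - g x)"
| mult: "explicit_function V f \<Longrightarrow> explicit_function V g \<Longrightarrow> explicit_function V (\<lambda>x. f x * g x)"
| divide: "explicit_function V f \<Longrightarrow> explicit_function V g \<Longrightarrow> explicit_function V (\<lambda>x. f x / g x)"
| powr: "explicit_function V f \<Longrightarrow> explicit_function V g \<Longrightarrow> explicit_function V (\<lambda>x. f x powr g x)"
| exp: "explicit_function V f \<Longrightarrow> explicit_function V (\<lambda>x. exp (f x))"
| ln: "explicit_function V f \<Longrightarrow> explicit_function V (\<lambda>x. ln (f x))"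
| min: "explicit_function V f \<Longrightarrow> explicit_function V g \<Longrightarrow> explicit_function V (\<lambda>x. min (f x) (g x))"
| max: "explicit_function V f \<Longrightarrow> explicit_function V g \<Longrightarrow> explicit_function V (\<lambda>x. max (f x) (g x))"

definition explicit3 :: "(real \<Rightarrow> real \<Rightarrow> real \<Rightarrow> real) \<Rightarrow> bool" where
  "explicit3 F \<longleftrightarrow>
     explicit_function {\<lambda>(a, b, c). a, \<lambda>(a, b, c). b, \<lambda>(a, b, c). c} (\<lambda>(a, b, c). F a b c)"

definition explicit4 :: "(real \<Rightarrow> real \<Rightarrow> real \<Rightarrow> real \<Rightarrow> real) \<Rightarrow> bool" where
  "explicit4 F \<longleftrightarrow>
     explicit_function {\<lambda>(a, b, c, d). a, \<lambda>(a, b, c, d). b, \<lambda>(a, b, c, d). c, \<lambda>(a, b, c, d). d}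
       (\<lambda>(a, b, c, d). F a b c d)"

end

theory Submission
  imports Defs "HOL-Complex_Analysis.Complex_Analysis"
begin

text \<open>Let \<open>T z\<close> be the generating function of the tails \<open>T k = p (k + 1) + p (k + 2) + \<dots>\<close>. Since
  \<open>T z * (1 - z) = 1 - P z\<close>, the increments of \<open>u\<close> are the Taylor coefficients of \<open>1 / T\<close>, and they
  add up to \<open>1 / T 1 = \<pi>1\<close>; the invariant delay is \<open>T k / T 1\<close>. On the unit disc \<open>\<bar>T z\<bar>\<close> is at
  least \<open>\<beta> * \<bar>1 - z\<bar> / 2\<close> and, since \<open>T 1 \<ge> 1\<close> and \<open>T\<close> has a Lipschitz constant \<open>S\<close>, at least
  \<open>1 - S * \<bar>1 - z\<bar>\<close>. Together these give an explicit positive lower bound, half of which survives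
  on a slightly larger disc of radius \<open>t > 1\<close>. Cauchy's inequality then bounds the coefficients of
  \<open>1 / T\<close> by a constant times \<open>1 / t ^ n\<close>, and \<open>\<rho>\<close> is the square root of \<open>t\<close>.\<close>

section \<open>Renewal sequences and formal power series\<close>

text \<open>As a finite sum this makes the identities below purely formal. For total mass 1 it is
  the mass of \<open>p\<close> beyond \<open>k\<close>.\<close>

definition tail :: "(nat \<Rightarrow> real) \<Rightarrow> nat \<Rightarrow> real" where
  "tail p k = 1 - (\<Sum>i\<le>k. p i)"

text \<open>The identities are proved over the reals; Cauchy's inequality needs the same
  coefficients as a complex series.\<close>

definition of_real_fps :: "real fps \<Rightarrow> complex fps" where
  "of_real_fps F = Abs_fps (\<lambda>n. of_real (fps_nth F n))"

lemma fps_nth_of_real_fps [simp]: "fps_nth (of_real_fps F) n = of_real (fps_nth F n)"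
  by (simp add: of_real_fps_def)

lemma of_real_fps_mult: "of_real_fps (F * G) = of_real_fps F * of_real_fps G"
  by (rule fps_ext) (simp add: fps_mult_nth)

lemma of_real_fps_diff: "of_real_fps (F - G) = of_real_fps F - of_real_fps G"
  by (rule fps_ext) simp

lemma of_real_fps_1: "of_real_fps 1 = 1"
  by (rule fps_ext) simp

lemma of_real_fps_X: "of_real_fps fps_X = fps_X"
  by (rule fps_ext) simp

lemma Abs_fps_conv: "Abs_fps (conv f g) = Abs_fps f * Abs_fps g"
  by (rule fps_ext) (simp add: conv_def fps_mult_nth)

lemma conv_unit_mass: "conv unit_mass g = g"
proof -
  have "Abs_fps unit_mass = 1"
    by (rule fps_ext) (simp add: unit_mass_def)
  then have "Abs_fps (conv unit_mass g) = Abs_fps g"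
    by (simp add: Abs_fps_conv)
  then show ?thesis
    by (simp add: fps_eq_iff fun_eq_iff)
qed

lemma Abs_fps_conv_power: "Abs_fps (conv_power p m) = Abs_fps p ^ m"
proof (induction m)
  case 0
  show ?case by (rule fps_ext) (simp add: unit_mass_def)
qed (simp add: Abs_fps_conv)

lemma conv_power_eq_nth: "conv_power p m n = fps_nth (Abs_fps p ^ m) n"
  by (simp flip: Abs_fps_conv_power)

text \<open>With \<open>p 0 = 0\<close> the power \<open>m\<close> of the series starts at degree
  \<open>m\<close> or later, so one truncation at \<open>N\<close> serves all coefficients up to
  \<open>N\<close>.\<close>

lemma zero_delay_renewal_eq_nth:
  assumes "p 0 = 0" "n \<le> N"
  shows "zero_delay_renewal p n = fps_nth (\<Sum>m\<le>N. Abs_fps p ^ m) n"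
proof -
  have "zero_delay_renewal p n = (\<Sum>m. fps_nth (Abs_fps p ^ m) n)"
    by (simp add: zero_delay_renewal_def renewal_sequence_def conv_unit_mass conv_power_eq_nth)
  also have "\<dots> = (\<Sum>m\<le>N. fps_nth (Abs_fps p ^ m) n)"
    using assms by (intro suminf_finite) (auto simp: startsby_zero_power_prefix)
  finally show ?thesis by (simp add: fps_sum_nth)
qed

text \<open>Coefficient \<open>n\<close> of the product sees only coefficients up to
  \<open>n\<close> of the renewal series, so the finite geometric sum suffices; its remainder has no
  term of degree \<open>n\<close>.\<close>

lemma renewal_equation:
  assumes "p 0 = 0"
  shows "(1 - Abs_fps p) * Abs_fps (zero_delay_renewal p) = 1"
proof (rule fps_ext)
  fix n
  let ?P = "Abs_fps p"
  have "fps_nth ((1 - ?P) * Abs_fps (zero_delay_renewal p)) n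
      = fps_nth ((1 - ?P) * (\<Sum>m\<le>n. ?P ^ m)) n"
    unfolding fps_mult_nth using assms
    by (intro sum.cong refl) (simp add: zero_delay_renewal_eq_nth[where N = n])
  also have "(1 - ?P) * (\<Sum>m\<le>n. ?P ^ m) = 1 - ?P ^ Suc n"
    by (rule sum_gp_basic)
  also have "fps_nth (?P ^ Suc n) n = 0"
    using assms startsby_zero_power_prefix[of ?P "Suc n"] by auto
  then have "fps_nth (1 - ?P ^ Suc n) n = fps_nth 1 n"
    by (simp only: fps_sub_nth diff_0_right)
  finally show "fps_nth ((1 - ?P) * Abs_fps (zero_delay_renewal p)) n = fps_nth 1 n" .
qed

lemma tail_fps:
  assumes "p 0 = 0"
  shows "Abs_fps (tail p) * (1 - fps_X) = 1 - Abs_fps p"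
proof (rule fps_ext)
  fix n show "fps_nth (Abs_fps (tail p) * (1 - fps_X)) n = fps_nth (1 - Abs_fps p) n"
    using assms by (cases n) (auto simp: tail_def right_diff_distrib)
qed

text \<open>The second factor is the series of the increments \<open>u n - u (n - 1)\<close>; it is
  thereby the formal inverse of the tail series.\<close>

lemma tail_fps_mult_renewal:
  assumes "p 0 = 0"
  shows "Abs_fps (tail p) * (Abs_fps (zero_delay_renewal p) * (1 - fps_X)) = 1"
  using renewal_equation[of p, OF assms] tail_fps[of p, OF assms] by (metis mult.assoc mult.commute)

lemma geometric_fps: "Abs_fps (\<lambda>_. 1) * (1 - fps_X) = (1 :: real fps)"
proof (rule fps_ext)
  fix n show "fps_nth (Abs_fps (\<lambda>_. 1) * (1 - fps_X)) n = fps_nth (1 :: real fps) n"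
    by (cases n) (auto simp: right_diff_distrib)
qed

text \<open>Both sides, multiplied by \<open>1 - fps_X\<close>, become 1, and this factor cancels.
  Normalised, this says that the renewal sequence with stationary delay is constant.\<close>

lemma conv_tail_renewal:
  assumes "p 0 = 0"
  shows "conv (tail p) (zero_delay_renewal p) n = 1"
proof -
  let ?F = "Abs_fps (conv (tail p) (zero_delay_renewal p))" and ?G = "Abs_fps (\<lambda>_. 1) :: real fps"
  have "?F * (1 - fps_X) = ?G * (1 - fps_X)"
    using tail_fps_mult_renewal[of p, OF assms]
    by (simp add: Abs_fps_conv mult.assoc geometric_fps)
  moreover have "1 - fps_X \<noteq> (0 :: real fps)"
    by (auto simp: fps_eq_iff intro!: exI[of _ 0])
  ultimately have "?F = ?G"
    by (metis mult_right_cancel)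
  then show ?thesis by (simp add: fps_eq_iff)
qed

lemma sum_renewal_diff:
  "(\<Sum>m\<le>n. fps_nth (Abs_fps u * (1 - fps_X)) m) = (u n :: real)"
  by (induction n) (auto simp: right_diff_distrib)

section \<open>Lipschitz bounds for power series\<close>

text \<open>The exponent of \<open>t\<close> is \<open>k\<close> instead of \<open>k - 1\<close>,
  which costs only a factor \<open>t\<close> and keeps the induction free of truncated
  subtraction.\<close>

lemma norm_power_diff_le:
  fixes z w :: complex
  assumes "norm z \<le> t" "norm w \<le> t" "1 \<le> t"
  shows "norm (z ^ k - w ^ k) \<le> real k * t ^ k * norm (z - w)"
proof (induction k)
  case (Suc k)
  have "z ^ Suc k - w ^ Suc k = z * (z ^ k - w ^ k) + (z - w) * w ^ k"
    by (simp add: algebra_simps)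
  also have "norm \<dots> \<le> norm z * norm (z ^ k - w ^ k) + norm (z - w) * norm w ^ k"
    by (metis norm_mult norm_power norm_triangle_ineq)
  also have "\<dots> \<le> t * (real k * t ^ k * norm (z - w)) + norm (z - w) * t ^ Suc k"
  proof (intro add_mono mult_mono Suc assms order_refl)
    have "norm w ^ k \<le> t ^ k" using assms by (intro power_mono) auto
    also have "\<dots> \<le> t ^ Suc k" using assms by (intro power_increasing) auto
    finally show "norm w ^ k \<le> t ^ Suc k" .
  qed (use assms in auto)
  finally show ?case by (simp add: algebra_simps)
qed simp

lemma norm_eval_fps_diff_le:
  fixes F :: "complex fps"
  assumes "norm z \<le> t" "norm w \<le> t" "1 \<le> t" "ereal t < fps_conv_radius F"
    and S: "summable (\<lambda>k. real k * t ^ k * norm (fps_nth F k))"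
  shows "norm (eval_fps F z - eval_fps F w)
    \<le> norm (z - w) * (\<Sum>k. real k * t ^ k * norm (fps_nth F k))"
proof -
  have rad: "norm z < fps_conv_radius F" "norm w < fps_conv_radius F"
    using assms(1,2,4) by (metis ereal_less_eq(3) le_less_trans)+
  have eq: "eval_fps F z - eval_fps F w = (\<Sum>k. fps_nth F k * (z ^ k - w ^ k))"
    unfolding eval_fps_def using rad
    by (subst suminf_diff) (auto intro!: summable_fps simp: algebra_simps)
  have le: "norm (fps_nth F k * (z ^ k - w ^ k))
      \<le> norm (z - w) * (real k * t ^ k * norm (fps_nth F k))" for k
    using mult_left_mono[OF norm_power_diff_le[OF assms(1-3), of k], of "norm (fps_nth F k)"]
    by (simp add: norm_mult mult_ac)
  have "norm (\<Sum>k. fps_nth F k * (z ^ k - w ^ k))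
      \<le> (\<Sum>k. norm (z - w) * (real k * t ^ k * norm (fps_nth F k)))"
    by (rule norm_suminf_le[OF le summable_mult[OF S]])
  also have "\<dots> = norm (z - w) * (\<Sum>k. real k * t ^ k * norm (fps_nth F k))"
    by (rule suminf_mult[OF S])
  finally show ?thesis by (simp add: eq)
qed

lemma sums_nat_mult_power:
  fixes x :: real
  assumes "norm x < 1"
  shows "(\<lambda>k. real k * x ^ k) sums (x / (1 - x)\<^sup>2)"
proof -
  have "(\<lambda>n. x * (real (Suc n) * x ^ n)) sums (x * (1 / (1 - x)\<^sup>2))"
    using geometric_deriv_sums[OF assms] by (intro sums_mult) simp
  then have "(\<lambda>n. real (Suc n) * x ^ Suc n) sums (x / (1 - x)\<^sup>2)"
    by (simp add: mult_ac)
  \<comment> \<open>The term at index 0 vanishes, so undoing the shift leaves the value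
    unchanged.\<close>
  then show ?thesis
    by (subst (asm) sums_Suc_iff) simp
qed

section \<open>The generating function of the tails\<close>

text \<open>The hypotheses as ordinary series over all of \<open>nat\<close>, which the power series
  lemmas expect; index 0 contributes nothing.\<close>

locale light_tailed_increments =
  fixes p :: "nat \<Rightarrow> real" and r \<beta> B :: real
  assumes p_0: "p 0 = 0"
    and p_nonneg: "\<And>n. 0 \<le> p n"
    and p_sums: "p sums 1"
    and p_1: "\<beta> \<le> p 1"
    and \<beta>_pos: "0 < \<beta>"
    and r_gt_1: "1 < r"
    and summable_p_power: "summable (\<lambda>n. p n * r ^ n)"
    and suminf_p_power: "(\<Sum>n. p n * r ^ n) \<le> B"
begin

lemma tail_0 [simp]: "tail p 0 = 1"
  by (simp add: tail_def p_0)

lemma tail_eq_suminf: "tail p k = (\<Sum>n. p (n + Suc k))"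
  using suminf_minus_initial_segment[OF sums_summable[OF p_sums], of "Suc k"] sums_unique[OF p_sums]
  by (simp add: tail_def lessThan_Suc_atMost)

lemma tail_nonneg: "0 \<le> tail p k"
  unfolding tail_eq_suminf using p_nonneg sums_summable[OF p_sums]
  by (intro suminf_nonneg) (simp_all only: summable_iff_shift)

text \<open>An exponential Markov inequality: every index beyond \<open>k\<close> carries a weight
  of at least \<open>r ^ k\<close> in the sum bounded by \<open>B\<close>.\<close>

lemma tail_mult_power_le: "tail p k * r ^ k \<le> B"
proof -
  have "tail p k * r ^ k = (\<Sum>n. p (n + Suc k) * r ^ k)"
    unfolding tail_eq_suminf using sums_summable[OF p_sums]
    by (intro suminf_mult2) (simp only: summable_iff_shift)
  also have "\<dots> \<le> (\<Sum>n. p (n + Suc k) * r ^ (n + Suc k))"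
  proof (intro suminf_le mult_left_mono power_increasing p_nonneg)
    show "summable (\<lambda>n. p (n + Suc k) * r ^ k)"
      using sums_summable[OF p_sums] by (intro summable_mult2) (simp only: summable_iff_shift)
    show "summable (\<lambda>n. p (n + Suc k) * r ^ (n + Suc k))"
      using summable_p_power summable_iff_shift[of "\<lambda>n. p n * r ^ n" "Suc k"] by blast
  qed (use r_gt_1 in auto)
  also have "\<dots> = (\<Sum>n. p n * r ^ n) - (\<Sum>n<Suc k. p n * r ^ n)"
    by (rule suminf_minus_initial_segment[OF summable_p_power])
  also have "\<dots> \<le> (\<Sum>n. p n * r ^ n)"
    using sum_nonneg[of "{..<Suc k}" "\<lambda>n. p n * r ^ n"] p_nonneg r_gt_1 by simp
  finally show ?thesis using suminf_p_power by linarith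
qed

lemma tail_le: "tail p k \<le> B * (1 / r) ^ k"
  using tail_mult_power_le[of k] r_gt_1 by (simp add: power_one_over field_simps)

lemma B_ge_1: "1 \<le> B"
  using tail_le[of 0] by simp

text \<open>The ratio \<open>x\<close> stays free: \<open>x = t / r\<close> gives summability, while
  other choices give moment bounds in which \<open>r\<close> does not occur.\<close>

lemma tail_power_le:
  assumes "0 \<le> t" "t \<le> r * x"
  shows "t ^ k * tail p k \<le> B * x ^ k"
proof -
  have "t ^ k * tail p k \<le> (r * x) ^ k * (B * (1 / r) ^ k)"
    using assms tail_le tail_nonneg by (intro mult_mono power_mono) auto
  also have "\<dots> = B * x ^ k"
    using r_gt_1 by (simp add: power_mult_distrib power_one_over)
  finally show ?thesis .
qed

lemma summable_tail_power:
  assumes "0 \<le> t" "t < r"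
  shows "summable (\<lambda>k. tail p k * t ^ k)"
proof (rule summable_comparison_test')
  show "summable (\<lambda>k. B * (t / r) ^ k)"
    using assms by (intro summable_mult summable_geometric) simp
  show "norm (tail p k * t ^ k) \<le> B * (t / r) ^ k" for k
    using tail_power_le[of t "t / r" k] assms tail_nonneg[of k] r_gt_1 by (simp add: mult.commute)
qed

text \<open>This is \<open>t\<close> times the derivative of the tail generating function at
  \<open>t\<close>. For \<open>1 < t < r\<close> it serves as its Lipschitz constant on the closed
  disc of radius \<open>t\<close>.\<close>

definition moment :: "real \<Rightarrow> real" where
  "moment t = (\<Sum>k. real k * t ^ k * tail p k)"

lemma
  assumes "0 \<le> t" "t \<le> r * x" "0 \<le> x" "x < 1"
  shows summable_moment: "summable (\<lambda>k. real k * t ^ k * tail p k)"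
    and moment_le: "moment t \<le> B * (x / (1 - x)\<^sup>2)"
proof -
  have sums: "(\<lambda>k. B * (real k * x ^ k)) sums (B * (x / (1 - x)\<^sup>2))"
    using assms by (intro sums_mult sums_nat_mult_power) auto
  have le: "real k * t ^ k * tail p k \<le> B * (real k * x ^ k)" for k
    using mult_left_mono[OF tail_power_le[OF assms(1,2), of k], of "real k"] by (simp add: mult_ac)
  show s: "summable (\<lambda>k. real k * t ^ k * tail p k)"
  proof (rule summable_comparison_test'[OF sums_summable[OF sums]])
    show "norm (real k * t ^ k * tail p k) \<le> B * (real k * x ^ k)" for k
      using le[of k] tail_nonneg[of k] assms(1) by simp
  qed
  show "moment t \<le> B * (x / (1 - x)\<^sup>2)"
    unfolding moment_def using suminf_le[OF le s sums_summable[OF sums]] sums_unique[OF sums] by simp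
qed

section \<open>Values of the generating functions inside radius \<open>r\<close>\<close>

abbreviation tail_gf :: "complex fps" where
  "tail_gf \<equiv> of_real_fps (Abs_fps (tail p))"

abbreviation increment_gf :: "complex fps" where
  "increment_gf \<equiv> of_real_fps (Abs_fps p)"

lemma conv_radius_tail: "fps_conv_radius tail_gf \<ge> r"
  unfolding fps_conv_radius_def
proof (rule conv_radius_geI_ex')
  fix s assume "0 < s" "ereal s < ereal r"
  then have "summable (\<lambda>k. tail p k * s ^ k)" by (intro summable_tail_power) auto
  then show "summable (\<lambda>n. fps_nth tail_gf n * complex_of_real s ^ n)"
    by (simp flip: of_real_power of_real_mult add: summable_complex_of_real)
qed

lemma conv_radius_increment: "fps_conv_radius increment_gf \<ge> r"
proof -
  have "summable (\<lambda>n. fps_nth increment_gf n * complex_of_real r ^ n)"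
    using summable_p_power by (simp flip: of_real_power of_real_mult add: summable_complex_of_real)
  then have "conv_radius (fps_nth increment_gf) \<ge> norm (complex_of_real r)"
    by (rule conv_radius_geI)
  then show ?thesis using r_gt_1 by (simp add: fps_conv_radius_def)
qed

lemma less_conv_radius:
  assumes "x < r"
  shows "ereal x < fps_conv_radius tail_gf" "ereal x < fps_conv_radius increment_gf"
  using less_le_trans[OF _ conv_radius_tail, of "ereal x"]
    less_le_trans[OF _ conv_radius_increment, of "ereal x"] assms by simp_all

lemma eval_tail_mult:
  assumes "norm z < r"
  shows "eval_fps tail_gf z * (1 - z) = 1 - eval_fps increment_gf z"
proof -
  have rad: "norm z < fps_conv_radius tail_gf" "norm z < fps_conv_radius increment_gf"
    using less_conv_radius[OF assms] by simp_all
  \<comment> \<open>Viewing \<open>1 - fps_X\<close> as a polynomial gives its value and its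
    infinite radius of convergence at once.\<close>
  have "1 - fps_X = fps_of_poly [:1, -1 :: complex:]"
    by (rule fps_ext) (simp add: coeff_pCons split: nat.split)
  then have X: "eval_fps (1 - fps_X) z = 1 - z" "fps_conv_radius (1 - fps_X :: complex fps) = \<infinity>"
    by (simp_all only: eval_fps_of_poly fps_conv_radius_fps_of_poly) simp
  have "tail_gf * (1 - fps_X) = 1 - increment_gf"
    using arg_cong[OF tail_fps[of p, OF p_0], of of_real_fps]
    by (simp add: of_real_fps_mult of_real_fps_diff of_real_fps_1 of_real_fps_X)
  then have "eval_fps (tail_gf * (1 - fps_X)) z = eval_fps (1 - increment_gf) z"
    by simp
  then show ?thesis
    using rad X by (simp add: eval_fps_mult eval_fps_diff)
qed

text \<open>The term \<open>p 1\<close> alone already forces \<open>Re (1 - P z) \<ge> \<beta> * (1 - Re z)\<close>, which is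
  aperiodicity in quantitative form.\<close>

lemma norm_eval_tail_ge_dist:
  assumes "norm z \<le> 1"
  shows "\<beta> / 2 * norm (1 - z) \<le> norm (eval_fps tail_gf z)"
proof (cases "z = 1")
  case False
  have "norm z < fps_conv_radius increment_gf"
    using assms r_gt_1 less_conv_radius(2)[of "norm z"] by simp
  then have "(\<lambda>n. fps_nth increment_gf n * z ^ n) sums eval_fps increment_gf z"
    by (rule sums_eval_fps)
  then have "(\<lambda>n. Re (fps_nth increment_gf n * z ^ n)) sums Re (eval_fps increment_gf z)"
    by (rule sums_Re)
  then have sums: "(\<lambda>n. p n * (1 - Re (z ^ n))) sums (1 - Re (eval_fps increment_gf z))"
    using sums_diff[OF p_sums] by (simp add: right_diff_distrib)
  have Re_le: "Re (z ^ n) \<le> 1" for n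
    using complex_Re_le_cmod[of "z ^ n"] assms power_le_one[of "norm z" n]
    by (simp add: norm_power)
  have "(\<Sum>n\<in>{1}. p n * (1 - Re (z ^ n))) \<le> (\<Sum>n. p n * (1 - Re (z ^ n)))"
    using sums_summable[OF sums] p_nonneg Re_le by (intro sum_le_suminf) auto
  then have "p 1 * (1 - Re z) \<le> 1 - Re (eval_fps increment_gf z)"
    using sums_unique[OF sums] by simp
  moreover have "\<beta> * (1 - Re z) \<le> p 1 * (1 - Re z)"
    using p_1 Re_le[of 1] by (intro mult_right_mono) auto
  moreover have "(norm (1 - z))\<^sup>2 \<le> 2 * (1 - Re z)"
  proof -
    have "(norm (1 - z))\<^sup>2 = 1 - 2 * Re z + (norm z)\<^sup>2"
      unfolding cmod_power2 by (simp add: power2_eq_square algebra_simps)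
    moreover have "(norm z)\<^sup>2 \<le> 1" using assms by (simp add: power_le_one)
    ultimately show ?thesis by simp
  qed
  then have "\<beta> / 2 * (norm (1 - z))\<^sup>2 \<le> \<beta> * (1 - Re z)"
    using mult_left_mono[of _ _ "\<beta> / 2"] \<beta>_pos by fastforce
  ultimately have "\<beta> / 2 * (norm (1 - z))\<^sup>2 \<le> Re (1 - eval_fps increment_gf z)"
    by simp
  also have "\<dots> \<le> norm (1 - eval_fps increment_gf z)"
    by (rule complex_Re_le_cmod)
  also have "\<dots> = norm (eval_fps tail_gf z) * norm (1 - z)"
    using eval_tail_mult[of z] assms r_gt_1 by (simp add: norm_mult [symmetric])
  \<comment> \<open>One factor \<open>norm (1 - z)\<close> cancels, since \<open>z\<close> is not
    1.\<close>
  finally show ?thesis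
    using False by (simp add: power2_eq_square)
qed simp

text \<open>The mean of an increment, so that \<open>1 / tail_sum\<close> is the limit in the
  renewal theorem.\<close>

definition tail_sum :: real where
  "tail_sum = (\<Sum>k. tail p k)"

lemma summable_tail: "summable (tail p)"
  using summable_tail_power[of 1] r_gt_1 by simp

lemma eval_tail_1: "eval_fps tail_gf 1 = of_real tail_sum"
  unfolding eval_fps_def tail_sum_def using suminf_of_real[OF summable_tail, where 'a = complex] by simp

lemma tail_sum_ge_1: "1 \<le> tail_sum"
  using sum_le_suminf[OF summable_tail, of "{0}"] tail_nonneg by (simp add: tail_sum_def)

section \<open>Lower bounds for the tail generating function\<close>

context
  fixes t :: real
  assumes t: "1 < t" "t < r"
begin

lemma summable_moment_t: "summable (\<lambda>k. real k * t ^ k * tail p k)"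
  using t by (intro summable_moment[of t "t / r"]) auto

lemma moment_nonneg: "0 \<le> moment t"
  unfolding moment_def using tail_nonneg t by (intro suminf_nonneg summable_moment_t) auto

lemma norm_eval_tail_diff_le:
  assumes "norm z \<le> t" "norm w \<le> t"
  shows "norm (eval_fps tail_gf z - eval_fps tail_gf w) \<le> norm (z - w) * moment t"
proof -
  show ?thesis
    using less_conv_radius(1)[OF t(2)] norm_eval_fps_diff_le[of z t w tail_gf] assms t summable_moment_t tail_nonneg
    by (simp add: moment_def)
qed

text \<open>With \<open>s\<close> the distance from 1, the lower bound \<open>1 - s * S\<close>
  falls and \<open>\<beta> / 2 * s\<close> grows. They cross at
  \<open>s = 2 / (\<beta> + 2 * S)\<close>, with the claimed value.\<close>

lemma norm_eval_tail_ge_disc: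
  assumes "norm z \<le> 1"
  shows "\<beta> / (\<beta> + 2 * moment t) \<le> norm (eval_fps tail_gf z)"
proof -
  define s S where "s = norm (1 - z)" and "S = moment t"
  have S: "0 \<le> S" by (simp add: S_def moment_nonneg)
  have "norm (eval_fps tail_gf 1) - norm (eval_fps tail_gf z) \<le> s * S"
    using norm_eval_tail_diff_le[of 1 z] assms t
      norm_triangle_ineq2[of "eval_fps tail_gf 1" "eval_fps tail_gf z"] unfolding s_def S_def
    by simp
  then have 1: "1 - s * S \<le> norm (eval_fps tail_gf z)"
    using tail_sum_ge_1 by (simp add: eval_tail_1)
  have 2: "\<beta> / 2 * s \<le> norm (eval_fps tail_gf z)"
    using norm_eval_tail_ge_dist[OF assms] by (simp add: s_def)
  show ?thesis
  proof (cases "s \<ge> 2 / (\<beta> + 2 * S)")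
    case True
    then have "\<beta> / 2 * (2 / (\<beta> + 2 * S)) \<le> \<beta> / 2 * s"
      using \<beta>_pos by (intro mult_left_mono) auto
    also have "\<beta> / 2 * (2 / (\<beta> + 2 * S)) = \<beta> / (\<beta> + 2 * S)"
      by simp
    finally show ?thesis using 2 unfolding S_def by linarith
  next
    case False
    then have "s * S \<le> 2 / (\<beta> + 2 * S) * S"
      using S by (intro mult_right_mono) auto
    moreover have "1 - 2 / (\<beta> + 2 * S) * S = \<beta> / (\<beta> + 2 * S)"
      using S \<beta>_pos by (simp add: field_simps)
    ultimately show ?thesis using 1 by (simp add: S_def)
  qed
qed

text \<open>Moving \<open>z\<close> radially to the unit disc changes the value by at most
  \<open>(t - 1) * moment t\<close>, which by hypothesis is at most half of the bound there.\<close>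

lemma norm_eval_tail_ge:
  assumes "(t - 1) * moment t \<le> \<beta> / (2 * (\<beta> + 2 * moment t))" "norm z \<le> t"
  shows "\<beta> / (2 * (\<beta> + 2 * moment t)) \<le> norm (eval_fps tail_gf z)"
proof -
  define d where "d = \<beta> / (2 * (\<beta> + 2 * moment t))"
  have d: "\<beta> / (\<beta> + 2 * moment t) = 2 * d"
    by (simp add: d_def del: distrib_left_numeral)
  define w where "w = (if norm z \<le> 1 then z else z / of_real (norm z))"
  have w: "norm w \<le> 1" by (auto simp: w_def norm_divide)
  have "norm (z - w) \<le> t - 1"
  proof (cases "norm z \<le> 1")
    case False
    then have "z \<noteq> 0" by auto
    then have "z - w = of_real (norm z - 1) * w"
      using False by (simp add: w_def field_simps)
    then have "norm (z - w) = (norm z - 1) * norm w"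
      using False by (simp only: norm_mult norm_of_real)
    moreover have "norm w = 1"
      using False \<open>z \<noteq> 0\<close> by (simp add: w_def norm_divide)
    ultimately show ?thesis using assms by simp
  qed (use t in \<open>simp add: w_def\<close>)
  then have "norm (z - w) * moment t \<le> (t - 1) * moment t"
    by (intro mult_right_mono moment_nonneg)
  moreover have "norm (eval_fps tail_gf w) - norm (eval_fps tail_gf z) \<le> norm (z - w) * moment t"
    using norm_eval_tail_diff_le[of z w] assms w t
      norm_triangle_ineq3[of "eval_fps tail_gf z" "eval_fps tail_gf w"] by simp
  moreover have "(t - 1) * moment t \<le> d"
    using assms by (simp only: d_def)
  moreover have "2 * d \<le> norm (eval_fps tail_gf w)"
    using norm_eval_tail_ge_disc[OF w] by (simp only: d)
  ultimately show ?thesis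
    unfolding d_def[symmetric] by linarith
qed

end

end

section \<open>Geometric convergence of the renewal sequence\<close>

context light_tailed_increments
begin

abbreviation u :: "nat \<Rightarrow> real" where
  "u \<equiv> zero_delay_renewal p"

abbreviation du :: "real fps" where
  "du \<equiv> Abs_fps u * (1 - fps_X)"

lemma inverse_tail_gf: "inverse tail_gf = of_real_fps du"
proof -
  have "tail_gf * of_real_fps du = 1"
    using tail_fps_mult_renewal[of p, OF p_0] by (simp flip: of_real_fps_mult add: of_real_fps_1)
  then show ?thesis by (rule fps_inverse_unique)
qed

text \<open>The lower bound makes \<open>1 / T\<close> holomorphic and bounded on the closed disc of
  radius \<open>t\<close>. Its Taylor coefficients are those of \<open>du\<close>: evaluation at 1
  gives their sum, Cauchy's inequality their decay.\<close>

lemma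
  assumes t: "1 < t" "t < r"
    and c: "(t - 1) * moment t \<le> \<beta> / (2 * (\<beta> + 2 * moment t))"
  shows du_sums: "fps_nth du sums (1 / tail_sum)"
    and abs_du_le: "\<bar>fps_nth du n\<bar> \<le> 2 * (\<beta> + 2 * moment t) / \<beta> * (1 / t) ^ n"
proof -
  define f where "f = (\<lambda>z. inverse (eval_fps tail_gf z))"
  define c where "c = \<beta> / (2 * (\<beta> + 2 * moment t))"
  have c_pos: "0 < c"
    using \<beta>_pos moment_nonneg[OF t] by (auto simp: c_def intro!: divide_pos_pos)
  have lower: "c \<le> norm (eval_fps tail_gf z)" if "norm z \<le> t" for z
    using norm_eval_tail_ge[OF t assms(3) that] by (simp add: c_def)
  have "cball (0 :: complex) t \<subseteq> eball 0 (fps_conv_radius tail_gf)"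
  proof
    fix z :: complex
    assume "z \<in> cball 0 t"
    then have "norm z < r" using t by simp
    then show "z \<in> eball 0 (fps_conv_radius tail_gf)"
      using less_conv_radius(1)[of "norm z"] by (simp add: eball_def)
  qed
  then have "eval_fps tail_gf holomorphic_on cball 0 t"
    by (rule holomorphic_on_eval_fps)
  moreover have "eval_fps tail_gf z \<noteq> 0" if "z \<in> cball 0 t" for z
    using lower[of z] that c_pos by auto
  ultimately have holo: "f holomorphic_on cball 0 t"
    unfolding f_def by (rule holomorphic_on_inverse)
  have "0 < fps_conv_radius tail_gf"
    using less_conv_radius(1)[of 0] r_gt_1 by (simp flip: zero_ereal_def)
  then have "eval_fps tail_gf has_fps_expansion tail_gf"
    by (rule eval_fps_has_fps_expansion)
  then have "f has_fps_expansion of_real_fps du"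
    using has_fps_expansion_inverse unfolding f_def inverse_tail_gf[symmetric] by fastforce
  then have nth: "complex_of_real (fps_nth du n) = (deriv ^^ n) f 0 / fact n" for n
    using fps_nth_fps_expansion by fastforce
  have holo': "f holomorphic_on ball 0 t"
    by (rule holomorphic_on_subset[OF holo]) auto
  \<comment> \<open>Because \<open>t > 1\<close>, the point 1 lies in the open disc, where the
    Taylor series converges to \<open>f\<close>.\<close>
  have "(\<lambda>n. (deriv ^^ n) f 0 / fact n * (1 - 0) ^ n) sums f 1"
    using t by (intro holomorphic_power_series[OF holo']) auto
  moreover have "f 1 = of_real (1 / tail_sum)"
    by (simp add: f_def eval_tail_1 field_simps)
  ultimately have "(\<lambda>n. complex_of_real (fps_nth du n)) sums of_real (1 / tail_sum)"
    by (simp only: nth) simp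
  then show "fps_nth du sums (1 / tail_sum)"
    by (simp only: sums_of_real_iff)
  have "norm ((deriv ^^ n) f 0) \<le> fact n * (1 / c) / t ^ n"
  proof (rule Cauchy_inequality[OF holo'])
    show "continuous_on (cball 0 t) f"
      by (rule holomorphic_on_imp_continuous_on[OF holo])
    show "norm (f z) \<le> 1 / c" if "norm (0 - z) = t" for z
      using le_imp_inverse_le[OF lower[of z] c_pos] that by (simp add: f_def norm_inverse flip: inverse_eq_divide)
  qed (use t in auto)
  then have "norm ((deriv ^^ n) f 0 / fact n) \<le> 1 / c * (1 / t) ^ n"
    by (simp add: norm_divide power_one_over field_simps)
  then have "norm (complex_of_real (fps_nth du n)) \<le> 1 / c * (1 / t) ^ n"
    by (simp only: nth)
  then show "\<bar>fps_nth du n\<bar> \<le> 2 * (\<beta> + 2 * moment t) / \<beta> * (1 / t) ^ n"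
    by (simp add: c_def)
qed

text \<open>Since \<open>u n\<close> is the partial sum of \<open>du\<close> up to \<open>n\<close>,
  the error is the remainder from \<open>n + 1\<close> on, dominated by a geometric series.\<close>

lemma abs_renewal_diff_le:
  assumes t: "1 < t" "t < r"
    and c: "(t - 1) * moment t \<le> \<beta> / (2 * (\<beta> + 2 * moment t))"
  shows "\<bar>u n - 1 / tail_sum\<bar> \<le> 2 * (\<beta> + 2 * moment t) / \<beta> / (t - 1) * (1 / t) ^ n"
proof -
  define M where "M = 2 * (\<beta> + 2 * moment t) / \<beta>"
  have du: "\<bar>fps_nth du m\<bar> \<le> M * (1 / t) ^ m" for m
    using abs_du_le[OF assms] by (simp add: M_def)
  have "(\<lambda>m. (1 / t) ^ m) sums (1 / (1 - 1 / t))"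
    using t by (intro geometric_sums) simp
  then have geo: "(\<lambda>m. M * (1 / t) ^ Suc n * (1 / t) ^ m) sums (M * (1 / t) ^ Suc n * (1 / (1 - 1 / t)))"
    by (rule sums_mult)
  have "(\<Sum>m. fps_nth du (m + Suc n)) = 1 / tail_sum - (\<Sum>m<Suc n. fps_nth du m)"
    using suminf_minus_initial_segment[OF sums_summable[OF du_sums[OF assms]], of "Suc n"]
      sums_unique[OF du_sums[OF assms]] by simp
  then have "u n - 1 / tail_sum = - (\<Sum>m. fps_nth du (m + Suc n))"
    using sum_renewal_diff[of u n] by (simp only: lessThan_Suc_atMost)
  then have "\<bar>u n - 1 / tail_sum\<bar> = norm (\<Sum>m. fps_nth du (m + Suc n))"
    by simp
  also have "\<dots> \<le> (\<Sum>m. M * (1 / t) ^ Suc n * (1 / t) ^ m)"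
  proof (rule norm_suminf_le[OF _ sums_summable[OF geo]])
    show "norm (fps_nth du (m + Suc n)) \<le> M * (1 / t) ^ Suc n * (1 / t) ^ m" for m
      using du[of "m + Suc n"] by (simp only: power_add real_norm_def mult_ac)
  qed
  also have "\<dots> = M * (1 / t) ^ Suc n * (1 / (1 - 1 / t))"
    by (rule sums_unique[OF geo, symmetric])
  also have "\<dots> = M / (t - 1) * (1 / t) ^ n"
    using t by (simp add: field_simps)
  finally show ?thesis by (simp add: M_def)
qed

text \<open>The equilibrium distribution of renewal theory: tail probability divided by the
  mean.\<close>

definition stationary_delay :: "nat \<Rightarrow> real" where
  "stationary_delay n = tail p n / tail_sum"

lemma conv_stationary_delay: "conv stationary_delay u n = 1 / tail_sum"
  using conv_tail_renewal[of p, OF p_0, of n]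
  by (simp add: conv_def stationary_delay_def sum_divide_distrib[symmetric])

lemma stationary_delay_nonneg: "0 \<le> stationary_delay n"
  using tail_nonneg tail_sum_ge_1 by (simp add: stationary_delay_def)

lemma stationary_delay_has_sum: "(stationary_delay has_sum 1) UNIV"
proof (rule sums_nonneg_imp_has_sum)
  show "stationary_delay sums 1"
    using sums_divide[OF summable_sums[OF summable_tail], of tail_sum] tail_sum_ge_1
    unfolding stationary_delay_def tail_sum_def by simp
qed (rule stationary_delay_nonneg)

lemma invariant_stationary_delay: "invariant_delay p stationary_delay"
proof -
  have bij: "bij_betw (\<lambda>m. m - 1) {1..} (UNIV :: nat set)"
    by (rule bij_betwI[where g = Suc]) auto
  have "((\<lambda>m. stationary_delay (m - 1)) has_sum 1) {1..}"
    using has_sum_reindex_bij_betw[OF bij, of stationary_delay 1] stationary_delay_has_sum by blast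
  moreover have "((\<lambda>n. stationary_delay (n - 1) * forward_transition p n m) has_sum stationary_delay (m - 1)) {1..}"
    if m: "m \<ge> 1" for m
  proof -
    let ?f = "\<lambda>n. stationary_delay (n - 1) * forward_transition p n m"
    \<comment> \<open>State \<open>m\<close> is entered only from state 1, with probability
      \<open>p m\<close>, and from state \<open>m + 1\<close>. Up to normalisation the balance is
      \<open>tail p (m - 1) = p m + tail p m\<close>.\<close>
    have "stationary_delay 0 * p m + stationary_delay m = stationary_delay (m - 1)"
      using m by (cases m) (auto simp: stationary_delay_def tail_def p_0 simp flip: add_divide_distrib)
    then have "sum ?f {1, Suc m} = stationary_delay (m - 1)"
      using m by (simp add: forward_transition_def)
    then have "(?f has_sum stationary_delay (m - 1)) {1, Suc m}"
      using has_sum_finite[of "{1, Suc m}" ?f] by simp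
    then show ?thesis
      using m by (subst has_sum_cong_neutral[where T = "{1, Suc m}" and g = ?f])
        (auto simp: forward_transition_def)
  qed
  ultimately show ?thesis
    using stationary_delay_nonneg stationary_delay_has_sum
    by (simp add: invariant_delay_def delay_distribution_def invariant_distribution_def)
qed

text \<open>The error decays like \<open>(1 / \<rho> ^ 2) ^ n\<close> and the weight is at most
  \<open>\<rho> ^ n\<close>, which leaves a geometric series of ratio
  \<open>1 / \<rho>\<close>.\<close>

lemma weighted_renewal_diff:
  assumes \<rho>: "1 < \<rho>" "\<rho> ^ 2 < r"
    and c: "(\<rho> ^ 2 - 1) * moment (\<rho> ^ 2) \<le> \<beta> / (2 * (\<beta> + 2 * moment (\<rho> ^ 2)))"
    and s: "0 < s" "s \<le> \<rho>"
  shows "(\<lambda>n. \<bar>u n - 1 / tail_sum\<bar> * s ^ n) summable_on {1..}" (is ?summable)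
    and "(\<Sum>\<^sub>\<infinity>n\<in>{1..}. \<bar>u n - 1 / tail_sum\<bar> * s ^ n)
      \<le> 2 * (\<beta> + 2 * moment (\<rho> ^ 2)) / \<beta> / ((\<rho> ^ 2 - 1) * (\<rho> - 1))" (is ?bound)
proof -
  define K where "K = 2 * (\<beta> + 2 * moment (\<rho> ^ 2)) / \<beta> / (\<rho> ^ 2 - 1)"
  let ?f = "\<lambda>n. \<bar>u n - 1 / tail_sum\<bar> * s ^ n"
  have sq: "1 < \<rho> ^ 2" using \<rho> by (simp add: one_less_power)
  have le: "?f n \<le> K * (1 / \<rho>) ^ n" for n
  proof -
    have "?f n \<le> K * (1 / \<rho> ^ 2) ^ n * \<rho> ^ n"
      using abs_renewal_diff_le[OF sq \<rho>(2) c] s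
      unfolding K_def by (intro mult_mono power_mono) (auto intro: order_trans[OF abs_ge_zero])
    also have "\<dots> = K * (1 / \<rho>) ^ n"
      using \<rho> by (simp add: power2_eq_square power_mult_distrib power_one_over field_simps)
    finally show ?thesis .
  qed
  have "(\<lambda>n. (1 / \<rho>) ^ n) sums (1 / (1 - 1 / \<rho>))"
    using \<rho> by (intro geometric_sums) simp
  then have "(\<lambda>n. K * (1 / \<rho>) * (1 / \<rho>) ^ n) sums (K * (1 / \<rho>) * (1 / (1 - 1 / \<rho>)))"
    by (rule sums_mult)
  moreover have "K * (1 / \<rho>) * (1 / (1 - 1 / \<rho>)) = K / (\<rho> - 1)"
    using \<rho> by (simp add: field_simps)
  \<comment> \<open>The sum starts at index 1, hence the denominator
    \<open>\<rho> - 1\<close>.\<close>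
  ultimately have geo: "(\<lambda>n. K * (1 / \<rho>) ^ Suc n) sums (K / (\<rho> - 1))"
    by (simp only: power_Suc mult_ac)
  have summable: "summable (\<lambda>n. ?f (Suc n))"
    using le s by (intro summable_comparison_test'[OF sums_summable[OF geo], of 0])
      (simp del: power_Suc)
  then have "((\<lambda>n. ?f (Suc n)) has_sum (\<Sum>n. ?f (Suc n))) UNIV"
    using s by (intro sums_nonneg_imp_has_sum summable_sums) auto
  moreover have bij: "bij_betw Suc UNIV {1..}"
    by (rule bij_betwI[where g = "\<lambda>m. m - 1"]) auto
  ultimately have hs: "(?f has_sum (\<Sum>n. ?f (Suc n))) {1..}"
    using has_sum_reindex_bij_betw[OF bij, of ?f] by blast
  then show ?summable by (rule has_sum_imp_summable)
  have "(\<Sum>n. ?f (Suc n)) \<le> K / (\<rho> - 1)"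
    using suminf_le[OF le summable sums_summable[OF geo]] sums_unique[OF geo] by simp
  then show ?bound
    using infsumI[OF hs] by (simp add: K_def)
qed

end

section \<open>Explicit constants\<close>

text \<open>The bound \<open>B * (x / (1 - x)\<^sup>2)\<close> at \<open>x = 1 / y\<close>; the
  square is a product because natural powers are no constructor of
  \<open>explicit_function\<close>.\<close>

definition moment_bound :: "real \<Rightarrow> real \<Rightarrow> real" where
  "moment_bound B y = B * ((1 / y) / ((1 - 1 / y) * (1 - 1 / y)))"

text \<open>\<open>C\<close> bounds the moment at every radius up to the square root of \<open>r\<close>, so the second argument
  of the minimum makes \<open>(t - 1) * moment t\<close> at most half the lower bound on the unit disc.\<close>

definition rate :: "real \<Rightarrow> real \<Rightarrow> real \<Rightarrow> real" where
  "rate r \<beta> B =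
     (let C = moment_bound B (r powr (1 / 2))
      in min (r powr (1 / 2)) (1 + \<beta> / (2 * C * (\<beta> + 2 * C))) powr (1 / 2))"

text \<open>The moment at radius \<open>\<rho> * \<rho>\<close> is bounded here without reference to \<open>r\<close>, which works because
  \<open>(\<rho> * \<rho>) * (\<rho> * \<rho>) \<le> r\<close>.\<close>

definition sum_bound :: "real \<Rightarrow> real \<Rightarrow> real \<Rightarrow> real \<Rightarrow> real" where
  "sum_bound s B \<beta> \<rho> =
     2 * (\<beta> + 2 * moment_bound B (\<rho> * \<rho>)) / \<beta> / ((\<rho> * \<rho> - 1) * (\<rho> - 1))"

lemma explicit_function_1: "explicit_function V (\<lambda>_. 1)"
  using explicit_function.const[of V 1] by simp

lemma explicit_function_2: "explicit_function V (\<lambda>_. 2)"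
  using explicit_function.const[of V 2] by simp

lemma explicit_function_moment_bound:
  assumes "explicit_function V f" "explicit_function V g"
  shows "explicit_function V (\<lambda>x. moment_bound (f x) (g x))"
  unfolding moment_bound_def
  by (intro explicit_function.intros(3-11) explicit_function_1 assms)

text \<open>The closure rules \<open>add\<close> to \<open>max\<close>; constants enter only as 1
  and 2, and coordinates are supplied separately.\<close>

lemmas explicit_function_intros =
  explicit_function.intros(3-11) explicit_function_1 explicit_function_2 explicit_function_moment_bound

lemma explicit3_rate: "explicit3 rate"
  unfolding explicit3_def rate_def Let_def case_prod_unfold
  by (intro explicit_function_intros explicit_function.coord) auto

lemma explicit4_sum_bound: "explicit4 sum_bound"
  unfolding explicit4_def sum_bound_def case_prod_unfold
  by (intro explicit_function_intros explicit_function.coord) auto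

context light_tailed_increments
begin

lemma moment_le_moment_bound:
  assumes "0 \<le> t" "1 < y" "t * y \<le> r"
  shows "moment t \<le> moment_bound B y"
  using moment_le[of t "1 / y"] assms by (simp add: moment_bound_def power2_eq_square field_simps)

text \<open>The square of the rate is the radius \<open>t\<close> of the analytic estimates. As
  \<open>t\<close> is at most the square root \<open>q\<close> of \<open>r\<close>, both
  \<open>t * q \<le> r\<close> and \<open>t * t \<le> r\<close> hold; the former bounds the moment
  by \<open>C\<close>.\<close>

lemma rate:
  shows rate_gt_1: "1 < rate r \<beta> B"
    and rate_le: "rate r \<beta> B ^ 2 * rate r \<beta> B ^ 2 \<le> r"
    and rate_moment: "(rate r \<beta> B ^ 2 - 1) * moment (rate r \<beta> B ^ 2)
      \<le> \<beta> / (2 * (\<beta> + 2 * moment (rate r \<beta> B ^ 2)))"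
proof -
  define q C where "q = r powr (1 / 2)" and "C = moment_bound B q"
  define t where "t = min q (1 + \<beta> / (2 * C * (\<beta> + 2 * C)))"
  have q: "1 < q" "q * q = r"
    using r_gt_1 by (simp_all add: q_def flip: powr_add)
  have C: "0 < C"
    using q B_ge_1 by (simp add: C_def moment_bound_def)
  have t: "1 < t" "t \<le> q"
    using q C \<beta>_pos by (simp_all add: t_def)
  have rate_eq: "rate r \<beta> B = t powr (1 / 2)"
    by (simp add: rate_def t_def C_def q_def Let_def)
  then show "1 < rate r \<beta> B"
    using t by (simp only: gr_one_powr)
  have sq: "rate r \<beta> B ^ 2 = t"
    using t by (simp add: rate_eq power2_eq_square flip: powr_add)
  have tt: "t * t \<le> q * q"
    using t by (intro mult_mono) auto
  then show "rate r \<beta> B ^ 2 * rate r \<beta> B ^ 2 \<le> r"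
    using q by (simp add: sq)
  have "t * q \<le> r"
    using mult_right_mono[OF t(2), of q] q by simp
  then have m: "moment t \<le> C"
    unfolding C_def using t q by (intro moment_le_moment_bound) auto
  have "t < r"
    using mult_strict_left_mono[OF q(1), of q] t q by simp
  then have m0: "0 \<le> moment t"
    using t by (intro moment_nonneg)
  \<comment> \<open>The second argument of the minimum bounds \<open>t - 1\<close>. Then
    \<open>C\<close> cancels, and replacing the remaining \<open>C\<close> by the smaller moment
    enlarges the fraction.\<close>
  have "(t - 1) * moment t \<le> \<beta> / (2 * C * (\<beta> + 2 * C)) * C"
    using t m m0 C \<beta>_pos by (intro mult_mono) (auto simp: t_def)
  also have "\<dots> = \<beta> / (2 * (\<beta> + 2 * C))"
    using C by simp
  also have "\<dots> \<le> \<beta> / (2 * (\<beta> + 2 * moment t))"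
    using m m0 \<beta>_pos by (intro divide_left_mono) auto
  finally show "(rate r \<beta> B ^ 2 - 1) * moment (rate r \<beta> B ^ 2)
      \<le> \<beta> / (2 * (\<beta> + 2 * moment (rate r \<beta> B ^ 2)))"
    by (simp only: sq)
qed

lemma explicit_renewal_bound:
  assumes "0 < s" "s \<le> rate r \<beta> B"
  shows "(\<lambda>n. \<bar>u n - 1 / tail_sum\<bar> * s ^ n) summable_on {1..}"
    and "(\<Sum>\<^sub>\<infinity>n\<in>{1..}. \<bar>u n - 1 / tail_sum\<bar> * s ^ n) \<le> sum_bound s B \<beta> (rate r \<beta> B)"
proof -
  define \<rho> where "\<rho> = rate r \<beta> B"
  have \<rho>: "1 < \<rho>" "\<rho> ^ 2 * \<rho> ^ 2 \<le> r"
    and c: "(\<rho> ^ 2 - 1) * moment (\<rho> ^ 2) \<le> \<beta> / (2 * (\<beta> + 2 * moment (\<rho> ^ 2)))"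
    using rate by (simp_all add: \<rho>_def)
  have sq: "1 < \<rho> ^ 2" using \<rho> by (simp add: one_less_power)
  then have "\<rho> ^ 2 * 1 < \<rho> ^ 2 * \<rho> ^ 2"
    by (intro mult_strict_left_mono) auto
  then have less: "\<rho> ^ 2 < r" using \<rho>(2) by linarith
  have s: "0 < s" "s \<le> \<rho>" using assms by (simp_all add: \<rho>_def)
  show "(\<lambda>n. \<bar>u n - 1 / tail_sum\<bar> * s ^ n) summable_on {1..}"
    by (rule weighted_renewal_diff(1)[OF \<rho>(1) less c s])
  \<comment> \<open>Taking \<open>y\<close> equal to the radius itself removes \<open>r\<close> from
    the bound.\<close>
  have "moment (\<rho> ^ 2) \<le> moment_bound B (\<rho> ^ 2)"
    using \<rho> sq by (intro moment_le_moment_bound) auto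
  then have "2 * (\<beta> + 2 * moment (\<rho> ^ 2)) / \<beta> / ((\<rho> ^ 2 - 1) * (\<rho> - 1))
      \<le> 2 * (\<beta> + 2 * moment_bound B (\<rho> ^ 2)) / \<beta> / ((\<rho> ^ 2 - 1) * (\<rho> - 1))"
    using \<rho> sq \<beta>_pos by (intro divide_right_mono mult_left_mono add_mono) auto
  with weighted_renewal_diff(2)[OF \<rho>(1) less c s]
  show "(\<Sum>\<^sub>\<infinity>n\<in>{1..}. \<bar>u n - 1 / tail_sum\<bar> * s ^ n) \<le> sum_bound s B \<beta> (rate r \<beta> B)"
    by (simp add: sum_bound_def power2_eq_square flip: \<rho>_def)
qed

end

lemma light_tailed_incrementsI:
  assumes p: "increment_distribution p" and "p 1 \<ge> \<beta>" "\<beta> > 0" "r > 1"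
    and summable: "(\<lambda>n. p n * r ^ n) summable_on {1..}"
    and le: "(\<Sum>\<^sub>\<infinity>n\<in>{1..}. p n * r ^ n) \<le> B"
  shows "light_tailed_increments p r \<beta> B"
proof -
  have p_0: "p 0 = 0" using p by (simp add: increment_distribution_def)
  \<comment> \<open>A zero value at index 0 lets a sum over \<open>{1..}\<close> be read as a series
    over \<open>nat\<close>.\<close>
  have sums: "f sums x" if "(f has_sum x) {1..}" "f 0 = 0" for f :: "nat \<Rightarrow> real" and x
  proof -
    have "(f has_sum x) UNIV"
      using that by (subst has_sum_cong_neutral[where T = "{1..}" and g = f]) (auto simp: not_le)
    then show ?thesis by (rule has_sum_imp_sums)
  qed
  have "(\<lambda>n. p n * r ^ n) sums (\<Sum>\<^sub>\<infinity>n\<in>{1..}. p n * r ^ n)"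
    using summable p_0 by (intro sums has_sum_infsum) auto
  moreover have "p sums 1"
    using p p_0 by (intro sums) (auto simp: increment_distribution_def)
  moreover have "0 \<le> p n" for n
    using p by (cases n) (auto simp: increment_distribution_def)
  ultimately show ?thesis
    using assms p_0 by unfold_locales (auto simp: sums_iff)
qed

theorem theorem2p2:
  shows "\<exists>(\<rho> :: real \<Rightarrow> real \<Rightarrow> real \<Rightarrow> real) (L :: real \<Rightarrow> real \<Rightarrow> real \<Rightarrow> real \<Rightarrow> real).
    explicit3 \<rho> \<and> explicit4 L \<and>
    (\<forall>(p :: nat \<Rightarrow> real) (r :: real) (\<beta> :: real) (B :: real).
       increment_distribution p \<longrightarrow> p 1 \<ge> \<beta> \<longrightarrow> \<beta> > 0 \<longrightarrow> r > 1 \<longrightarrow>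
       (\<lambda>n. p n * r ^ n) summable_on {1..} \<longrightarrow>
       (\<Sum>\<^sub>\<infinity>n\<in>{1..}. p n * r ^ n) \<le> B \<longrightarrow>
       (\<exists>(e :: nat \<Rightarrow> real) (\<pi>1 :: real).
          invariant_delay p e \<and>
          (\<forall>n. \<pi>1 = conv e (zero_delay_renewal p) n) \<and>
          \<rho> r \<beta> B > 1 \<and>
          (\<forall>r2. 0 < r2 \<and> r2 \<le> \<rho> r \<beta> B \<longrightarrow>
             (\<lambda>n. \<bar>zero_delay_renewal p n - \<pi>1\<bar> * r2 ^ n) summable_on {1..} \<and>
             (\<Sum>\<^sub>\<infinity>n\<in>{1..}. \<bar>zero_delay_renewal p n - \<pi>1\<bar> * r2 ^ n) \<le> L r2 B \<beta> (\<rho> r \<beta> B))))"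
proof (rule exI[of _ rate], rule exI[of _ sum_bound], intro conjI explicit3_rate explicit4_sum_bound allI impI)
  fix p :: "nat \<Rightarrow> real" and r \<beta> B :: real
  assume "increment_distribution p" "p 1 \<ge> \<beta>" "\<beta> > 0" "r > 1"
    "(\<lambda>n. p n * r ^ n) summable_on {1..}" "(\<Sum>\<^sub>\<infinity>n\<in>{1..}. p n * r ^ n) \<le> B"
  then interpret light_tailed_increments p r \<beta> B
    by (rule light_tailed_incrementsI)
  show "\<exists>e \<pi>1. invariant_delay p e \<and> (\<forall>n. \<pi>1 = conv e (zero_delay_renewal p) n) \<and>
      rate r \<beta> B > 1 \<and>
      (\<forall>r2. 0 < r2 \<and> r2 \<le> rate r \<beta> B \<longrightarrow>
         (\<lambda>n. \<bar>zero_delay_renewal p n - \<pi>1\<bar> * r2 ^ n) summable_on {1..} \<and>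
         (\<Sum>\<^sub>\<infinity>n\<in>{1..}. \<bar>zero_delay_renewal p n - \<pi>1\<bar> * r2 ^ n) \<le> sum_bound r2 B \<beta> (rate r \<beta> B))"
    using invariant_stationary_delay conv_stationary_delay rate_gt_1 explicit_renewal_bound
    by (intro exI[of _ stationary_delay] exI[of _ "1 / tail_sum"]) auto
qed

end
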